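(* Suppose the linear program $P:\ \min\{\mathbf c^T\mathbf x\mid\mathbf A\mathbf x=\mathbf b,\ \mathbf x\ge\mathbf 0\}$ is generated according to Generative Model 1 (defined in the context, with scale constant $\eta\ge0$). Let $\boldsymbol\xi$ be the uniform distribution over $[n]$, i.e., $\xi_j=1/n$ for all $j\in[n]$. Let $t\ge1$, and set $$C=t\cdot\eta\cdot(\log n+1).$$ Then with probability at least $1-1/t$, $P_{\mathrm{distr}}$ is feasible and $$\Delta v(P_{\mathrm{distr}})\le\frac{t\,\eta\,(1+\log n)}{\sqrt n}.$$
   Context: Generative Model 1 produces $(\mathbf A,\mathbf b,\mathbf c)$ as follows: (1) fix any constant $\eta\ge0$; (2) fix any matrix $\mathbf A=[\mathbf A_1\cdots\mathbf A_n]\in\mathbb R^{m\times n}$; (3) generate a random vector $\boldsymbol\theta=(\theta_1,\dots,\theta_n)\sim\mathrm{Dirichlet}(1,\dots,1)$ (the uniform distribution on the $(n-1)$-dimensional unit simplex); (4) set $\mathbf b=\eta\mathbf A\boldsymbol\theta=\eta\sum_{j=1}^n\theta_j\mathbf A_j$; (5) fix any $\mathbf c\in\mathbb R^n$ with $\|\mathbf c\|_2=1$ such that $v(P)\ge0$ ($\mathbf c$ is chosen after $\mathbf A$ and $\mathbf b$ and may depend on them; the manner of choice is otherwise arbitrary). $P_{\mathrm{distr}}:\ \min\{\mathbf c^T\mathbf x\mid\mathbf A\mathbf x=\mathbf b,\ \mathbf 0\le\mathbf x\le C\boldsymbol\xi\}$. $v(\cdot)$ denotes the optimal value and $\Delta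 v(P_{\mathrm{distr}})=v(P_{\mathrm{distr}})-v(P)$. $\log$ is the natural logarithm and $[n]=\{1,\dots,n\}$. *)

theory Defs
  imports "HOL-Probability.Probability"
begin

text \<open>
  Density of the Dirichlet distribution with parameters \<open>\<alpha>\<close>. The simplex is a null set of
  \<open>real ^ 'n\<close>, so as usual the density refers to Lebesgue measure in \<open>n - 1\<close> of the coordinates: the
  coordinate \<open>k\<close> is dropped and equals \<open>1\<close> minus the sum of the others. By symmetry the
  resulting distribution does not depend on \<open>k\<close>.
\<close>
definition dirichlet_density :: "'n::finite \<Rightarrow> real ^ 'n \<Rightarrow> ('n \<Rightarrow> real) \<Rightarrow> real" where
  "dirichlet_density k \<alpha> x =
     (if (\<forall>i\<in>UNIV - {k}. 0 < x i) \<and> (\<Sum>i\<in>UNIV - {k}. x i) < 1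
      then Gamma (\<Sum>i\<in>UNIV. \<alpha> $ i) / (\<Prod>i\<in>UNIV. Gamma (\<alpha> $ i))
             * (\<Prod>i\<in>UNIV - {k}. x i powr (\<alpha> $ i - 1))
             * (1 - (\<Sum>i\<in>UNIV - {k}. x i)) powr (\<alpha> $ k - 1)
      else 0)"

definition dirichlet :: "'n::finite \<Rightarrow> real ^ 'n \<Rightarrow> (real ^ 'n) measure" where
  "dirichlet k \<alpha> =
     distr (density (\<Pi>\<^sub>M i\<in>UNIV - {k}. lborel) (\<lambda>x. ennreal (dirichlet_density k \<alpha> x)))
       borel
       (\<lambda>x. \<chi> i. if i = k then 1 - (\<Sum>j\<in>UNIV - {k}. x j) else x i)"

text \<open>For \<open>\<alpha> = (1, \<dots>, 1)\<close> the density is constant on the simplex.\<close>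
lemma dirichlet_density_ones:
  fixes k :: "'n::finite"
  shows "dirichlet_density k (\<chi> i. 1) x =
           (if (\<forall>i\<in>UNIV - {k}. 0 < x i) \<and> (\<Sum>i\<in>UNIV - {k}. x i) < 1
            then fact (CARD('n) - 1) else 0)"
proof -
  have card: "real CARD('n) = 1 + real (CARD('n) - 1)"
    using zero_less_card_finite[where 'a = 'n] by linarith
  have "Gamma (real CARD('n)) = fact (CARD('n) - 1)"
    unfolding card by (rule Gamma_fact)
  moreover have "Gamma (1 :: real) = 1"
    using Gamma_fact[of 0, where 'a = real] by simp
  moreover have "(\<Prod>i\<in>UNIV - {k}. x i powr 0) = 1" if "\<forall>i\<in>UNIV - {k}. 0 < x i"
    by (rule prod.neutral) (use that in force)
  ultimately show ?thesis
    unfolding dirichlet_density_def by simp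
qed

definition lp_feasible :: "real ^ 'n ^ 'm \<Rightarrow> real ^ 'm \<Rightarrow> (real ^ 'n) set" where
  "lp_feasible A b = {x. A *v x = b \<and> (\<forall>j. 0 \<le> x $ j)}"

definition lp_distr_feasible ::
    "real ^ 'n ^ 'm \<Rightarrow> real ^ 'm \<Rightarrow> real \<Rightarrow> real ^ 'n \<Rightarrow> (real ^ 'n) set" where
  "lp_distr_feasible A b C \<xi> = {x. A *v x = b \<and> (\<forall>j. 0 \<le> x $ j \<and> x $ j \<le> C * \<xi> $ j)}"

text \<open>
  The optimal value is extended-real: \<open>\<infinity>\<close> for an infeasible and \<open>-\<infinity>\<close> for an unbounded problem.
\<close>
definition opt_value :: "real ^ 'n \<Rightarrow> (real ^ 'n) set \<Rightarrow> ereal" where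
  "opt_value c F = (INF x\<in>F. ereal (c \<bullet> x))"

text \<open>
  The objective vector of the random linear program may depend on the sample in an arbitrary,
  possibly non-measurable way. An event has probability at least \<open>p\<close> if it contains a measurable
  event of probability at least \<open>p\<close>; for measurable events this is the usual meaning.
\<close>
definition with_prob_at_least :: "'w measure \<Rightarrow> real \<Rightarrow> ('w \<Rightarrow> bool) \<Rightarrow> bool" where
  "with_prob_at_least M p Q \<longleftrightarrow>
     (\<exists>E\<in>sets M. (\<forall>\<omega>\<in>E. Q \<omega>) \<and> p \<le> measure M E)"

lemma (in prob_space) with_prob_at_least_iff:
  assumes "{\<omega> \<in> space M. Q \<omega>} \<in> events"
  shows "with_prob_at_least M p Q \<longleftrightarrow> p \<le> prob {\<omega> \<in> space M. Q \<omega>}"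
proof
  assume "with_prob_at_least M p Q"
  then obtain E where E: "E \<in> events" "\<forall>\<omega>\<in>E. Q \<omega>" "p \<le> prob E"
    by (auto simp: with_prob_at_least_def)
  then have "E \<subseteq> {\<omega> \<in> space M. Q \<omega>}"
    using sets.sets_into_space by blast
  then have "prob E \<le> prob {\<omega> \<in> space M. Q \<omega>}"
    using assms by (rule finite_measure_mono)
  with E show "p \<le> prob {\<omega> \<in> space M. Q \<omega>}" by simp
next
  assume "p \<le> prob {\<omega> \<in> space M. Q \<omega>}"
  with assms show "with_prob_at_least M p Q"
    unfolding with_prob_at_least_def
    by (intro bexI[of _ "{\<omega> \<in> space M. Q \<omega>}"]) simp_all
qed

end

theory Submission
  imports Defs
begin

text \<open>
  The vector \<open>\<eta> \<theta>\<close> is feasible for \<open>P\<close>. If no coordinate of \<open>\<theta>\<close> exceeds \<open>s = t (ln n + 1) / n\<close>, then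
  \<open>\<eta> \<theta>\<close> is also feasible for the restricted program, and since \<open>v(P) \<ge> 0\<close> and \<open>c\<close> is a unit vector
  the gap is at most the norm of \<open>\<eta> \<theta>\<close>, hence at most \<open>sqrt n\<close> times its largest entry.
  Cutting the simplex at \<open>\<theta>\<^sub>i > s\<close> leaves a simplex scaled by \<open>1 - s\<close>, so a coordinate exceeds \<open>s\<close> with
  probability at most \<open>(1 - s) ^ (n - 1)\<close>, and a union bound leaves the real inequality
  \<open>n (1 - s) ^ (n - 1) \<le> 1 / t\<close> for \<open>s < 1\<close>.
\<close>

section \<open>Volume of a simplex cut off at one coordinate\<close>

text \<open>Fubini isolates coordinate \<open>i\<close>; there the claim is translation invariance
  of Lebesgue measure on the line.\<close>

lemma nn_integral_PiM_lborel_shift: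
  fixes f :: "('i \<Rightarrow> real) \<Rightarrow> ennreal"
  assumes "finite I" "i \<in> I"
    and f [measurable]: "f \<in> borel_measurable (\<Pi>\<^sub>M i\<in>I. lborel)"
  shows "(\<integral>\<^sup>+x. f x \<partial>(\<Pi>\<^sub>M i\<in>I. lborel)) = (\<integral>\<^sup>+x. f (x(i := s + x i)) \<partial>(\<Pi>\<^sub>M i\<in>I. lborel))"
proof -
  interpret product_sigma_finite "\<lambda>_. lborel :: real measure"
    by standard
  define J where "J = I - {i}"
  have I: "I = insert i J" and J: "finite J" "i \<notin> J"
    using assms by (auto simp: J_def)
  have f' [measurable]: "f \<in> borel_measurable (\<Pi>\<^sub>M i\<in>insert i J. lborel)"
    using f I by simp
  have inner [measurable]: "(\<lambda>y. f (x(i := y))) \<in> borel_measurable borel"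
    if "x \<in> space (\<Pi>\<^sub>M i\<in>J. lborel)" for x
  proof -
    have "(\<lambda>y. f (x(i := y))) \<in> borel_measurable lborel"
      using f' that by measurable
    then show ?thesis by simp
  qed
  have "(\<lambda>x. x(i := s + x i)) \<in>
      (\<Pi>\<^sub>M i\<in>insert i J. lborel) \<rightarrow>\<^sub>M (\<Pi>\<^sub>M i\<in>insert i J. lborel)"
    by (rule measurable_fun_upd[where J = "insert i J"]) simp_all
  then have shift: "(\<lambda>x. f (x(i := s + x i))) \<in> borel_measurable (\<Pi>\<^sub>M i\<in>insert i J. lborel)"
    using f' by (rule measurable_compose)
  have "(\<integral>\<^sup>+x. f x \<partial>(\<Pi>\<^sub>M i\<in>I. lborel)) = (\<integral>\<^sup>+x. \<integral>\<^sup>+y. f (x(i := y)) \<partial>lborel \<partial>(\<Pi>\<^sub>M i\<in>J. lborel))"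
    unfolding I using J f' by (rule product_nn_integral_insert)
  also have "\<dots> = (\<integral>\<^sup>+x. \<integral>\<^sup>+y. f (x(i := s + y)) \<partial>lborel \<partial>(\<Pi>\<^sub>M i\<in>J. lborel))"
    using nn_integral_real_affine[OF inner, of _ 1 s] by (subst nn_integral_cong) simp_all
  also have "\<dots> = (\<integral>\<^sup>+x. f (x(i := s + x i)) \<partial>(\<Pi>\<^sub>M i\<in>insert i J. lborel))"
    using J shift by (subst product_nn_integral_insert) simp_all
  finally show ?thesis
    unfolding I .
qed

text \<open>Translating coordinate \<open>i\<close> by \<open>s\<close> turns the cut piece into the
  simplex of size \<open>1 - s\<close>, whose volume is known. Only one inclusion between the two
  sets is needed for the upper bound.\<close>

lemma emeasure_simplex_coordinate_ge:
  fixes i :: 'i and s :: real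
  assumes "finite I" "i \<in> I" "0 \<le> s" "s \<le> 1"
  shows "emeasure (\<Pi>\<^sub>M i\<in>I. lborel)
           {x \<in> space (\<Pi>\<^sub>M i\<in>I. lborel). (\<forall>j\<in>I. 0 \<le> x j) \<and> sum x I \<le> 1 \<and> s \<le> x i}
         \<le> ennreal ((1 - s) ^ card I / fact (card I))"
proof -
  have indicator_le: "(indicator U y :: ennreal) \<le> indicator V x" if "y \<in> U \<Longrightarrow> x \<in> V"
    for U V :: "('i \<Rightarrow> real) set" and x y
    using that by (auto simp: indicator_def)
  let ?P = "\<Pi>\<^sub>M i\<in>I. (lborel :: real measure)"
  let ?B = "{x \<in> space ?P. (\<forall>j\<in>I. 0 \<le> x j) \<and> sum x I \<le> 1 \<and> s \<le> x i}"
  let ?S = "{x. (\<forall>j\<in>I. 0 \<le> x j) \<and> sum x I \<le> 1 - s} \<inter> space ?P"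
  have B [measurable]: "?B \<in> sets ?P"
    using assms by measurable
  have "?S = {x \<in> space ?P. (\<forall>j\<in>I. 0 \<le> x j) \<and> sum x I \<le> 1 - s}"
    by auto
  then have S [measurable]: "?S \<in> sets ?P"
    using assms by simp
  have "emeasure ?P ?B = (\<integral>\<^sup>+x. indicator ?B x \<partial>?P)"
    using B by simp
  also have "\<dots> = (\<integral>\<^sup>+x. indicator ?B (x(i := s + x i)) \<partial>?P)"
    using assms by (intro nn_integral_PiM_lborel_shift) measurable
  also have "\<dots> \<le> (\<integral>\<^sup>+x. indicator ?S x \<partial>?P)"
  proof (intro nn_integral_mono)
    fix x assume x: "x \<in> space ?P"
    have "x \<in> ?S" if mem: "x(i := s + x i) \<in> ?B"
    proof -
      have "sum (x(i := s + x i)) I = s + sum x I"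
        using assms by (simp add: sum.remove[of I i])
      \<comment> \<open>At \<open>j = i\<close> the sign comes from the cut
        \<open>s \<le> s + x i\<close>; the other coordinates do not move.\<close>
      moreover have "0 \<le> x j" if "j \<in> I" for j
        using mem that by (cases "j = i") auto
      ultimately show ?thesis
        using mem x by auto
    qed
    then show "indicator ?B (x(i := s + x i)) \<le> (indicator ?S x :: ennreal)"
      by (rule indicator_le)
  qed
  also have "\<dots> = emeasure ?P ?S"
    using S by (rule nn_integral_indicator)
  also have "\<dots> = ennreal ((1 - s) ^ card I / fact (card I))"
    using assms by (intro emeasure_std_simplex_aux) auto
  finally show ?thesis .
qed

section \<open>Tail of one coordinate under the uniform Dirichlet law\<close>

text \<open>The density is constant on the open simplex, so probabilities become volumes in the
  \<open>n - 1\<close> retained coordinates.\<close>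

lemma emeasure_dirichlet_ones:
  fixes k :: "'n::finite"
  assumes [measurable]: "B \<in> sets borel"
  shows "emeasure (dirichlet k (\<chi> j. 1)) B =
           fact (CARD('n) - 1) * emeasure (\<Pi>\<^sub>M i\<in>UNIV - {k}. lborel)
             {x \<in> space (\<Pi>\<^sub>M i\<in>UNIV - {k}. lborel).
                (\<forall>i\<in>UNIV - {k}. 0 < x i) \<and> (\<Sum>i\<in>UNIV - {k}. x i) < 1 \<and>
                (\<chi> i. if i = k then 1 - (\<Sum>j\<in>UNIV - {k}. x j) else x i) \<in> B}"
proof -
  let ?P = "\<Pi>\<^sub>M i\<in>UNIV - {k}. (lborel :: real measure)"
  let ?g = "\<lambda>x. (\<chi> i. if i = k then 1 - (\<Sum>j\<in>UNIV - {k}. x j) else x i) :: real ^ 'n"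
  let ?Q = "\<lambda>x. (\<forall>i\<in>UNIV - {k}. 0 < x i) \<and> (\<Sum>i\<in>UNIV - {k}. x i) < (1 :: real)"
  have comp: "(\<lambda>x. if i = k then 1 - (\<Sum>j\<in>UNIV - {k}. x j) else x i) \<in> borel_measurable ?P" for i
    by (cases "i = k") simp_all
  have g [measurable]: "?g \<in> borel_measurable ?P"
    by (subst borel_measurable_euclidean_space)
      (auto simp: Basis_vec_def inner_axis intro!: comp)
  have Q [measurable]: "Measurable.pred ?P ?Q"
    by measurable
  have "emeasure (dirichlet k (\<chi> j. 1)) B =
      emeasure (density ?P (\<lambda>x. ennreal (dirichlet_density k (\<chi> j. 1) x))) (?g -` B \<inter> space ?P)"
    unfolding dirichlet_def by (subst emeasure_distr) simp_all
  also have "\<dots> = (\<integral>\<^sup>+x. ennreal (dirichlet_density k (\<chi> j. 1) x) * indicator (?g -` B \<inter> space ?P) x \<partial>?P)"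
    unfolding dirichlet_density_ones by (intro emeasure_density) measurable
  also have "\<dots> = (\<integral>\<^sup>+x. fact (CARD('n) - 1) * indicator {x \<in> space ?P. ?Q x \<and> ?g x \<in> B} x \<partial>?P)"
    unfolding dirichlet_density_ones
    by (intro nn_integral_cong) (auto simp: indicator_def ennreal_fact)
  also have "\<dots> = fact (CARD('n) - 1) * emeasure ?P {x \<in> space ?P. ?Q x \<and> ?g x \<in> B}"
    by (intro nn_integral_cmult_indicator) measurable
  finally show ?thesis
    by (simp add: conj_assoc)
qed

text \<open>The factor \<open>fact (n - 1)\<close> cancels the factorial in the simplex volume. The
  case \<open>1 \<le> s\<close> is set to 0 explicitly, since the power would be 1 for
  \<open>n = 1\<close> and can be negative or large for \<open>s > 1\<close>.\<close>

lemma emeasure_dirichlet_ones_coordinate: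
  fixes k i :: "'n::finite" and s :: real
  assumes s: "0 \<le> s"
  shows "emeasure (dirichlet k (\<chi> j. 1)) {x. x $ i < 0 \<or> s < x $ i}
         \<le> ennreal (if s < 1 then (1 - s) ^ (CARD('n) - 1) else 0)"
proof -
  let ?I = "UNIV - {k}"
  let ?P = "\<Pi>\<^sub>M i\<in>?I. (lborel :: real measure)"
  let ?g = "\<lambda>x. (\<chi> i. if i = k then 1 - (\<Sum>j\<in>?I. x j) else x i) :: real ^ 'n"
  let ?D = "{x \<in> space ?P. (\<forall>i\<in>?I. 0 < x i) \<and> (\<Sum>i\<in>?I. x i) < 1 \<and>
      ?g x \<in> {x. x $ i < 0 \<or> s < x $ i}}"
  have card: "card ?I = CARD('n) - 1"
    by (simp add: card_Diff_singleton)
  \<comment> \<open>Inside the simplex no coordinate is negative, which rules out the first disjunct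
    of the bad set.\<close>
  have coord: "s < ?g x $ i" "?g x $ i \<le> 1" if "x \<in> ?D" for x
  proof -
    have "0 < x j" if "j \<noteq> k" for j
      using \<open>x \<in> ?D\<close> that by auto
    then have nonneg: "0 \<le> x j" if "j \<in> ?I" for j
      using that by (auto intro: less_imp_le)
    have "x i \<le> sum x ?I" if "i \<noteq> k"
      using nonneg that by (intro member_le_sum) auto
    moreover have "0 \<le> sum x ?I"
      using nonneg by (rule sum_nonneg)
    ultimately show "s < ?g x $ i" "?g x $ i \<le> 1"
      using \<open>x \<in> ?D\<close> nonneg[of i] by (auto split: if_splits)
  qed
  have D: "emeasure ?P ?D \<le> ennreal (if s < 1 then (1 - s) ^ card ?I / fact (card ?I) else 0)"
  proof (cases "s < 1")
    case False
    then have "?D = {}"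
      using coord by force
    then show ?thesis
      by (simp only: emeasure_empty zero_le)
  next
    case True
    show ?thesis
    proof (cases "i = k")
      case i: True
      let ?S = "{x. (\<forall>j\<in>?I. 0 \<le> x j) \<and> sum x ?I \<le> 1 - s} \<inter> space ?P"
      have eq: "?S = {x \<in> space ?P. (\<forall>j\<in>?I. 0 \<le> x j) \<and> sum x ?I \<le> 1 - s}"
        by auto
      \<comment> \<open>For the dropped coordinate, \<open>s < 1 - sum x ?I\<close> already
        describes a simplex of size \<open>1 - s\<close>, so no translation is required. Strict
        bounds are relaxed to match the closed simplex.\<close>
      have "?D \<subseteq> ?S"
        using coord i by (force intro: less_imp_le)
      then have "emeasure ?P ?D \<le> emeasure ?P ?S"
        by (rule emeasure_mono) (subst eq, measurable)
      also have "\<dots> = ennreal ((1 - s) ^ card ?I / fact (card ?I))"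
        using True by (intro emeasure_std_simplex_aux) auto
      finally show ?thesis
        using True by simp
    next
      case i: False
      let ?S = "{x \<in> space ?P. (\<forall>j\<in>?I. 0 \<le> x j) \<and> sum x ?I \<le> 1 \<and> s \<le> x i}"
      have "?D \<subseteq> ?S"
        using coord i by (force intro: less_imp_le)
      moreover have "?S \<in> sets ?P"
        using i by auto
      ultimately have "emeasure ?P ?D \<le> emeasure ?P ?S"
        by (rule emeasure_mono)
      also have "\<dots> \<le> ennreal ((1 - s) ^ card ?I / fact (card ?I))"
        using True i s by (intro emeasure_simplex_coordinate_ge) auto
      finally show ?thesis
        using True by simp
    qed
  qed
  have "emeasure (dirichlet k (\<chi> j. 1)) {x. x $ i < 0 \<or> s < x $ i}
      = ennreal (fact (card ?I)) * emeasure ?P ?D"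
    unfolding card ennreal_fact by (rule emeasure_dirichlet_ones) measurable
  also have "\<dots> \<le> ennreal (fact (card ?I)) *
      ennreal (if s < 1 then (1 - s) ^ card ?I / fact (card ?I) else 0)"
    using D by (rule mult_left_mono) simp
  also have "\<dots> = ennreal (if s < 1 then (1 - s) ^ card ?I else 0)"
    by (subst ennreal_mult [symmetric]) auto
  finally show ?thesis
    unfolding card .
qed

section \<open>The real inequality behind the union bound\<close>

text \<open>Let \<open>a\<close> be the value of \<open>s\<close> at \<open>t = 1\<close>. Factoring
  \<open>1 - s = (1 - a) * (1 - r)\<close> separates two tasks: the power of \<open>1 - a\<close>
  absorbs the factor \<open>n\<close>, and the power of \<open>1 - r\<close> yields
  \<open>1 / t\<close>. Both use \<open>1 - x \<le> exp (- x)\<close>.\<close>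

lemma union_bound_le_inverse:
  fixes t :: real and n :: nat
  assumes n: "n \<ge> 1" and t: "t \<ge> 1"
    and s: "s = t * (ln (real n) + 1) / real n" "s < 1"
  shows "real n * (1 - s) ^ (n - 1) \<le> 1 / t"
proof -
  define a where "a = (ln (real n) + 1) / real n"
  have a_pos: "a > 0"
    using n ln_ge_zero[of "real n"] unfolding a_def by (intro divide_pos_pos add_nonneg_pos) auto
  have s_eq: "s = t * a"
    using s by (simp add: a_def)
  have a1: "a < 1"
    using s_eq s(2) t a_pos mult_right_mono[of 1 t a] by linarith
  have na: "real n * a = ln (real n) + 1"
    using n by (simp add: a_def)
  \<comment> \<open>Solved from \<open>(1 - a) * (1 - r) = 1 - t * a\<close>.\<close>
  define r where "r = (t - 1) * a / (1 - a)"
  have "(1 - a) * (1 - r) = 1 - s"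
    using a1 unfolding r_def s_eq by (simp add: field_simps)
  moreover have "1 - a \<le> exp (- a)" "1 - r \<le> exp (- r)"
    using exp_ge_add_one_self[of "- a"] exp_ge_add_one_self[of "- r"] by simp_all
  ultimately have "1 - s \<le> exp (- a) * exp (- r)"
    using a1 by (smt (verit) exp_ge_zero mult_left_mono mult_right_mono)
  then have "1 - s \<le> exp (- a - r)"
    by (simp add: exp_diff exp_minus field_simps)
  then have "(1 - s) ^ (n - 1) \<le> exp (- a - r) ^ (n - 1)"
    using s(2) by (intro power_mono) auto
  also have "\<dots> = exp ((real n - 1) * (- a - r))"
    using n by (simp add: exp_of_nat_mult [symmetric] of_nat_diff)
  finally have pow: "(1 - s) ^ (n - 1) \<le> exp ((real n - 1) * (- a - r))" .
  have "t - 1 \<le> (real n - 1) * r"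
  proof -
    \<comment> \<open>Equivalent to \<open>1 \<le> n * a\<close>, that is, to
      \<open>0 \<le> ln n\<close>.\<close>
    have "1 - a \<le> (real n - 1) * a"
      using na n ln_ge_zero[of "real n"] by (simp add: algebra_simps)
    then have "(t - 1) * (1 - a) \<le> (t - 1) * ((real n - 1) * a)"
      using t by (intro mult_left_mono) auto
    then show ?thesis
      using a1 by (simp add: r_def field_simps)
  qed
  \<comment> \<open>Since \<open>n * a = ln n + 1\<close>, the terms without \<open>r\<close> and
    \<open>t\<close> add up to \<open>a - 1 < 0\<close>.\<close>
  then have expo: "ln (real n) + (real n - 1) * (- a - r) + (t - 1) \<le> 0"
    using na a1 by (simp add: algebra_simps)
  have "t \<le> exp (t - 1)"
    using exp_ge_add_one_self[of "t - 1"] by simp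
  then have "real n * (1 - s) ^ (n - 1) * t \<le> real n * exp ((real n - 1) * (- a - r)) * exp (t - 1)"
    using pow t s(2) by (intro mult_mono) auto
  also have "\<dots> = exp (ln (real n) + (real n - 1) * (- a - r) + (t - 1))"
    using n by (simp only: exp_add) simp
  also have "\<dots> \<le> 1"
    using expo by simp
  finally show ?thesis
    using t by (simp add: pos_le_divide_eq)
qed

section \<open>Deterministic bound on the optimality gap\<close>

lemma norm_vec_le_sqrt_card:
  fixes x :: "real ^ 'n::finite"
  assumes "\<And>j. \<bar>x $ j\<bar> \<le> B"
  shows "norm x \<le> sqrt (real CARD('n)) * B"
proof -
  have B: "0 \<le> B"
    using assms[of undefined] by linarith
  have "norm x = sqrt (\<Sum>j\<in>UNIV. \<bar>x $ j\<bar>\<^sup>2)"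
    by (simp add: norm_vec_def L2_set_def)
  also have "\<dots> \<le> sqrt (\<Sum>j\<in>(UNIV :: 'n set). B\<^sup>2)"
    using assms by (intro real_sqrt_le_mono sum_mono power_mono) auto
  also have "\<dots> = sqrt (real CARD('n)) * B"
    using B by (simp add: real_sqrt_mult)
  finally show ?thesis .
qed

text \<open>The point \<open>x\<close> witnesses feasibility, and by Cauchy-Schwarz its cost is at
  most \<open>norm x\<close>. Subtracting a nonnegative optimal value can only lower this bound.
  Nothing here is random, so it applies separately to each outcome.\<close>

lemma opt_value_restricted_gap:
  fixes A :: "real ^ 'n ^ 'm::finite" and c x \<xi> :: "real ^ 'n::finite"
  assumes "norm c = 1" "0 \<le> opt_value c (lp_feasible A b)"
    and "A *v x = b" "\<And>j. 0 \<le> x $ j" "\<And>j. x $ j \<le> C * \<xi> $ j" "\<And>j. C * \<xi> $ j \<le> B"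
  shows "lp_distr_feasible A b C \<xi> \<noteq> {}"
    and "opt_value c (lp_distr_feasible A b C \<xi>) - opt_value c (lp_feasible A b)
         \<le> ereal (sqrt (real CARD('n)) * B)"
proof -
  let ?v = "opt_value c (lp_feasible A b)" and ?w = "opt_value c (lp_distr_feasible A b C \<xi>)"
  have x: "x \<in> lp_distr_feasible A b C \<xi>"
    using assms by (simp add: lp_distr_feasible_def)
  then show "lp_distr_feasible A b C \<xi> \<noteq> {}" by blast
  have "\<bar>x $ j\<bar> \<le> B" for j
    using assms(4-6)[of j] by linarith
  then have norm_x: "norm x \<le> sqrt (real CARD('n)) * B"
    by (rule norm_vec_le_sqrt_card)
  have "c \<bullet> x \<le> norm c * norm x"
    by (rule norm_cauchy_schwarz)
  also have "\<dots> \<le> sqrt (real CARD('n)) * B"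
    using assms(1) norm_x by simp
  finally have "?w \<le> ereal (sqrt (real CARD('n)) * B)"
    using x unfolding opt_value_def by (intro INF_lower2) auto
  moreover have "?w - ?v \<le> ?w - 0"
    using assms(2) by (intro ereal_minus_mono) auto
  ultimately show "?w - ?v \<le> ereal (sqrt (real CARD('n)) * B)"
    by (simp add: order_trans)
qed

section \<open>The good event and the gap on it\<close>

theorem theorem4:
  fixes M :: "'w measure"
    and k :: "'n::finite"
    and \<eta> t C :: real
    and A :: "real ^ 'n ^ 'm::finite"
    and \<theta> c :: "'w \<Rightarrow> real ^ 'n"
    and b :: "'w \<Rightarrow> real ^ 'm"
    and \<xi> :: "real ^ 'n"
  assumes "prob_space M"
    and "\<eta> \<ge> 0"
    and "\<theta> \<in> borel_measurable M"
    and "distr M borel \<theta> = dirichlet k (\<chi> j. 1)"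
    and "\<And>\<omega>. \<omega> \<in> space M \<Longrightarrow> b \<omega> = \<eta> *\<^sub>R (A *v \<theta> \<omega>)"
    and "\<And>\<omega>. \<omega> \<in> space M \<Longrightarrow> norm (c \<omega>) = 1"
    and "\<And>\<omega>. \<omega> \<in> space M \<Longrightarrow> 0 \<le> opt_value (c \<omega>) (lp_feasible A (b \<omega>))"
    and "\<xi> = (\<chi> j. 1 / real CARD('n))"
    and "t \<ge> 1"
    and "C = t * \<eta> * (ln (real CARD('n)) + 1)"
  shows "with_prob_at_least M (1 - 1 / t) (\<lambda>\<omega>.
           lp_distr_feasible A (b \<omega>) C \<xi> \<noteq> {} \<and>
           opt_value (c \<omega>) (lp_distr_feasible A (b \<omega>) C \<xi>)
             - opt_value (c \<omega>) (lp_feasible A (b \<omega>))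
           \<le> ereal (t * \<eta> * (1 + ln (real CARD('n))) / sqrt (real CARD('n))))"
proof -
  interpret prob_space M by fact
  note [measurable] = assms(3)
  let ?n = "real CARD('n)"
  define s where "s = t * (ln ?n + 1) / ?n"
  have n: "CARD('n) \<ge> 1"
    using zero_less_card_finite[where 'a = 'n] by linarith
  have "0 \<le> ln ?n"
    using n by (intro ln_ge_zero) simp
  then have s: "0 \<le> s"
    using assms(9) by (simp add: s_def)
  \<comment> \<open>Negative values count as bad because the law of \<open>\<theta>\<close> ensures
    nonnegativity only almost surely.\<close>
  define B where "B i = {x :: real ^ 'n. x $ i < 0 \<or> s < x $ i}" for i
  have B [measurable]: "B i \<in> sets borel" for i
    unfolding B_def by measurable
  define G where "G i = \<theta> -` B i \<inter> space M" for i
  have G [measurable]: "G i \<in> events" for i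
    unfolding G_def by measurable
  have prob_G: "prob (G i) \<le> (if s < 1 then (1 - s) ^ (CARD('n) - 1) else 0)" for i
  proof -
    have "emeasure M (G i) = emeasure (dirichlet k (\<chi> j. 1)) (B i)"
      unfolding G_def assms(4) [symmetric] by (simp add: emeasure_distr)
    also have "\<dots> \<le> ennreal (if s < 1 then (1 - s) ^ (CARD('n) - 1) else 0)"
      unfolding B_def using s by (rule emeasure_dirichlet_ones_coordinate)
    finally show ?thesis
      by (subst (asm) emeasure_eq_measure, subst (asm) ennreal_le_iff) auto
  qed
  have "prob (\<Union>i. G i) \<le> (\<Sum>i\<in>UNIV. prob (G i))"
    by (intro finite_measure_subadditive_finite) auto
  also have "\<dots> \<le> (\<Sum>i\<in>(UNIV :: 'n set). if s < 1 then (1 - s) ^ (CARD('n) - 1) else 0)"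
    using prob_G by (intro sum_mono) auto
  \<comment> \<open>If \<open>1 \<le> s\<close>, the sum is 0; this covers \<open>n = 1\<close>,
    where \<open>s = t\<close>.\<close>
  also have "\<dots> \<le> 1 / t"
    using union_bound_le_inverse[OF n assms(9) s_def] assms(9) by simp
  finally have bad: "prob (\<Union>i. G i) \<le> 1 / t" .
  show ?thesis
    unfolding with_prob_at_least_def
  proof (intro bexI conjI ballI)
    show "1 - 1 / t \<le> prob (space M - (\<Union>i. G i))"
      using bad by (subst prob_compl) auto
    \<comment> \<open>The event is defined through \<open>\<theta>\<close> alone, hence measurable
      however \<open>c\<close> is chosen.\<close>
    show "space M - (\<Union>i. G i) \<in> events"
      by measurable
    fix \<omega> assume "\<omega> \<in> space M - (\<Union>i. G i)"
    then have \<omega>: "\<omega> \<in> space M" and \<theta>: "0 \<le> \<theta> \<omega> $ j" "\<theta> \<omega> $ j \<le> s" for j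
      by (auto simp: G_def B_def not_less)
    \<comment> \<open>The threshold \<open>s\<close> was chosen so that the cap is exactly
      \<open>\<eta> * s\<close>.\<close>
    have Cs: "C * \<xi> $ j = \<eta> * s" for j
      using assms(8,10) by (simp add: s_def)
    note gap = opt_value_restricted_gap[where x = "\<eta> *\<^sub>R \<theta> \<omega>" and C = C and \<xi> = \<xi> and B = "\<eta> * s",
        OF assms(6)[OF \<omega>] assms(7)[OF \<omega>]]
    have feas: "A *v (\<eta> *\<^sub>R \<theta> \<omega>) = b \<omega>"
      using assms(5)[OF \<omega>] by (simp add: matrix_vector_mult_scaleR)
    have coord: "0 \<le> (\<eta> *\<^sub>R \<theta> \<omega>) $ j" "(\<eta> *\<^sub>R \<theta> \<omega>) $ j \<le> C * \<xi> $ j" for j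
      using \<theta>[of j] assms(2) unfolding Cs by (auto intro: mult_left_mono)
    show "lp_distr_feasible A (b \<omega>) C \<xi> \<noteq> {}"
      using gap(1)[OF feas coord] by (simp add: Cs)
    have "sqrt ?n * (\<eta> * s) = t * \<eta> * (1 + ln ?n) / sqrt ?n"
      using n by (simp add: s_def field_simps)
    then show "opt_value (c \<omega>) (lp_distr_feasible A (b \<omega>) C \<xi>)
        - opt_value (c \<omega>) (lp_feasible A (b \<omega>)) \<le> ereal (t * \<eta> * (1 + ln ?n) / sqrt ?n)"
      using gap(2)[OF feas coord] by (simp add: Cs)
  qed
qed

end
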